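(* Let $f:\mathbb{R}^n\to\mathbb{R}$ be smooth, strongly convex with parameters $L\ge\ell>0$ and minimizer $x^*$. Let $x_k,y_k,\tilde\sigma_k$ be the quantities generated by the Geometric Descent (GD) algorithm applied to $f$ from an arbitrary $x_0\in\mathbb{R}^n$. Then for all $k=1,2,\ldots$, $$\tilde\sigma_k^2\ge\|y_k-x^*\|^2+\frac{2(f(x_k)-f(x^* ))}{\ell}.$$
   Context: A differentiable convex function $f:\mathbb{R}^n\to\mathbb{R}$ is smooth, strongly convex with parameters $L\ge\ell>0$ if for all $x,y\in\mathbb{R}^n$, $\ \ell\|x-y\|^2/2\le f(y)-f(x)-\nabla f(x)^T(y-x)\le L\|x-y\|^2/2$. Such $f$ has a unique minimizer $x^*$. $\mathrm{aff}$ denotes affine hull. Geometric Descent (GD): $x_0$ is arbitrary, $y_0:=x_0$, $\tilde\sigma_0:=\sqrt{2}\,\|\nabla f(x_0)\|/\ell$. For $k=1,2,\ldots$: - $\bar x_{k-1}:=x_{k-1}-\nabla f(x_{k-1})/L$ and $\bar{\bar x}_{k-1}:=x_{k-1}-\nabla f(x_{k-1})/\ell$. - $\tilde\rho_{k-1}:=\|\nabla f(x_{k-1})\|/\ell$. - If $\tilde\sigma_{k-1}^2\le 2\tilde\rho_{k-1}^2$, set $\delta_{k-1}:=\|y_{k-1}-\bar{\bar x}_{k-1}\|$, $$\lambda_k:=\frac{\delta_{k-1}^2+\tilde\rho_{k-1}^2-\tilde\sigma_{k-1}^2}{2\delta_{k-1}^2},\qquad \tilde\xi_k^*:=\frac12\sqrt{2\tilde\rho_{k-1}^2+2\tilde\sigma_{k-1}^2-\delta_{k-1}^2-\frac{(\tilde\rho_{k-1}^2-\tilde\sigma_{k-1}^2)^2}{\delta_{k-1}^2}}.$$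 Otherwise set $\lambda_k:=0$. - $y_k:=(1-\lambda_k)\bar{\bar x}_{k-1}+\lambda_k y_{k-1}$. - $x_k:=\mathrm{argmin}\{f(x):x\in\mathrm{aff}\{\bar x_{k-1},y_k\}\}$ (exact line search). - With $\gamma_j:=2(f(x_j)-f(x^* ))/\ell$ (so $\gamma_k-\gamma_{k-1}=2(f(x_k)-f(x_{k-1}))/\ell$), set $\tilde\sigma_k:=\sqrt{(\tilde\xi_k^* )^2-\gamma_{k-1}+\gamma_k}$ in the first case ($\tilde\sigma_{k-1}^2\le 2\tilde\rho_{k-1}^2$) and $\tilde\sigma_k:=\sqrt{\tilde\rho_{k-1}^2-\gamma_{k-1}+\gamma_k}$ in the other case. The formulas of the first case presuppose $\delta_{k-1}\ne0$; the algorithm is considered as long as these formulas are defined. *)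

theory Defs
  imports "HOL-Analysis.Analysis"
begin

definition gradient :: "('a::euclidean_space \<Rightarrow> real) \<Rightarrow> 'a \<Rightarrow> 'a" where
  "gradient f x = (THE D. GDERIV f x :> D)"

lemma gderiv_gradient:
  fixes f :: "'a::euclidean_space \<Rightarrow> real"
  assumes "f differentiable (at x)"
  shows "GDERIV f x :> gradient f x"
proof -
  obtain F where F: "(f has_derivative F) (at x)"
    using assms by (auto simp: differentiable_def)
  define D where "D = adjoint F 1"
  have "linear F"
    using F by (rule has_derivative_linear)
  then have "F = (\<lambda>h. inner h D)"
    using adjoint_works[of F _ 1] by (simp add: D_def fun_eq_iff)
  with F have D: "GDERIV f x :> D"
    by (simp add: gderiv_def)
  have "E = D" if "GDERIV f x :> E" for E
  proof -
    have "(\<lambda>h. inner h E) = (\<lambda>h. inner h D)"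
      using has_derivative_unique that D unfolding gderiv_def by blast
    then show ?thesis
      by (metis vector_eq_ldot)
  qed
  with D show ?thesis
    unfolding gradient_def by (rule theI)
qed

definition smooth_strongly_convex ::
  "real \<Rightarrow> real \<Rightarrow> ('a::euclidean_space \<Rightarrow> real) \<Rightarrow> bool" where
  "smooth_strongly_convex L l f \<longleftrightarrow>
     0 < l \<and> l \<le> L \<and> convex_on UNIV f \<and> (\<forall>x. f differentiable (at x)) \<and>
     (\<forall>x y. l * (norm (x - y))\<^sup>2 / 2 \<le> f y - f x - inner (gradient f x) (y - x) \<and>
            f y - f x - inner (gradient f x) (y - x) \<le> L * (norm (x - y))\<^sup>2 / 2)"

text \<open>With \<open>c = L\<close> this is the point written with one bar, with \<open>c = l\<close> the one with two bars.\<close>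

definition grad_step :: "('a::euclidean_space \<Rightarrow> real) \<Rightarrow> real \<Rightarrow> 'a \<Rightarrow> 'a" where
  "grad_step f c x = x - (1 / c) *\<^sub>R gradient f x"

definition gd_rho :: "('a::euclidean_space \<Rightarrow> real) \<Rightarrow> real \<Rightarrow> 'a \<Rightarrow> real" where
  "gd_rho f l x = norm (gradient f x) / l"

definition gd_delta :: "('a::euclidean_space \<Rightarrow> real) \<Rightarrow> real \<Rightarrow> 'a \<Rightarrow> 'a \<Rightarrow> real" where
  "gd_delta f l x y = norm (y - grad_step f l x)"

definition gd_gamma :: "('a::euclidean_space \<Rightarrow> real) \<Rightarrow> real \<Rightarrow> 'a \<Rightarrow> 'a \<Rightarrow> real" where
  "gd_gamma f l xstar x = 2 * (f x - f xstar) / l"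

text \<open>The arguments \<open>x\<close>, \<open>y\<close>, \<open>s\<close> are the values of the previous iteration, where \<open>s\<close> stands
  for \<open>\<sigma>\<close> with a tilde. The case distinction of the algorithm depends on them only.\<close>

definition gd_case1 :: "('a::euclidean_space \<Rightarrow> real) \<Rightarrow> real \<Rightarrow> 'a \<Rightarrow> real \<Rightarrow> bool" where
  "gd_case1 f l x s \<longleftrightarrow> s\<^sup>2 \<le> 2 * (gd_rho f l x)\<^sup>2"

definition gd_lambda :: "('a::euclidean_space \<Rightarrow> real) \<Rightarrow> real \<Rightarrow> 'a \<Rightarrow> 'a \<Rightarrow> real \<Rightarrow> real" where
  "gd_lambda f l x y s =
     (if gd_case1 f l x s
      then ((gd_delta f l x y)\<^sup>2 + (gd_rho f l x)\<^sup>2 - s\<^sup>2) / (2 * (gd_delta f l x y)\<^sup>2)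
      else 0)"

definition gd_xi :: "('a::euclidean_space \<Rightarrow> real) \<Rightarrow> real \<Rightarrow> 'a \<Rightarrow> 'a \<Rightarrow> real \<Rightarrow> real" where
  "gd_xi f l x y s =
     1 / 2 * sqrt (2 * (gd_rho f l x)\<^sup>2 + 2 * s\<^sup>2 - (gd_delta f l x y)\<^sup>2
                   - ((gd_rho f l x)\<^sup>2 - s\<^sup>2)\<^sup>2 / (gd_delta f l x y)\<^sup>2)"

text \<open>One iteration from \<open>(x, y, s)\<close> to \<open>(x', y', s')\<close>. In the first case it exists only if
  \<open>gd_delta\<close> is nonzero. Nonnegativity of the arguments of \<open>sqrt\<close> is not required, so that a
  statement about all iterations does not assume it.\<close>

definition gd_step ::
  "('a::euclidean_space \<Rightarrow> real) \<Rightarrow> real \<Rightarrow> real \<Rightarrow> 'a \<Rightarrow> 'a \<Rightarrow> 'a \<Rightarrow> real \<Rightarrow> 'a \<Rightarrow> 'a \<Rightarrow> real \<Rightarrow> bool"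
  where
  "gd_step f L l xstar x y s x' y' s' \<longleftrightarrow>
     (gd_case1 f l x s \<longrightarrow> gd_delta f l x y \<noteq> 0) \<and>
     y' = (1 - gd_lambda f l x y s) *\<^sub>R grad_step f l x + gd_lambda f l x y s *\<^sub>R y \<and>
     is_arg_min f (\<lambda>z. z \<in> affine hull {grad_step f L x, y'}) x' \<and>
     s' = (if gd_case1 f l x s
           then sqrt ((gd_xi f l x y s)\<^sup>2 - gd_gamma f l xstar x + gd_gamma f l xstar x')
           else sqrt ((gd_rho f l x)\<^sup>2 - gd_gamma f l xstar x + gd_gamma f l xstar x'))"

text \<open>The first \<open>N\<close> iterations of the algorithm are defined and generate the sequences \<open>x\<close>, \<open>y\<close>,
  \<open>s\<close> up to index \<open>N\<close>; later entries are unconstrained.\<close>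

definition gd_run ::
  "('a::euclidean_space \<Rightarrow> real) \<Rightarrow> real \<Rightarrow> real \<Rightarrow> 'a \<Rightarrow> nat \<Rightarrow>
   (nat \<Rightarrow> 'a) \<Rightarrow> (nat \<Rightarrow> 'a) \<Rightarrow> (nat \<Rightarrow> real) \<Rightarrow> bool"
  where
  "gd_run f L l xstar N x y s \<longleftrightarrow>
     y 0 = x 0 \<and>
     s 0 = sqrt 2 * norm (gradient f (x 0)) / l \<and>
     (\<forall>k\<in>{1..N}. gd_step f L l xstar (x (k - 1)) (y (k - 1)) (s (k - 1)) (x k) (y k) (s k))"

end

theory Submission
  imports Defs
begin

text \<open>By strong convexity, \<open>xstar\<close> lies in the ball around \<open>grad_step f l x\<close> of squared radius
  \<open>\<rho>\<^sup>2 - \<gamma>\<close>, and by induction in the ball around \<open>y\<close> of squared radius \<open>s\<^sup>2 - \<gamma>\<close>.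
  The new \<open>y\<close> is the centre, and \<open>\<xi>\<^sup>2 - \<gamma>\<close> the squared radius, of the smallest ball that contains the
  intersection of the two. The squared distance of \<open>xstar\<close> from it is estimated by Stewart's identity,
  which needs the weight \<open>\<lambda>\<close> to lie in \<open>[0, 1]\<close>. The exact line search makes the gradient at
  \<open>x\<close> orthogonal to \<open>y - x\<close>, so \<open>\<delta>\<^sup>2 = (norm (y - x))\<^sup>2 + \<rho>\<^sup>2 \<ge> \<rho>\<^sup>2\<close>; with \<open>s\<^sup>2 \<le> 2 \<rho>\<^sup>2\<close>
  this gives \<open>0 \<le> \<lambda> \<le> 1\<close>.\<close>

lemma smooth_strongly_convex_lower:
  assumes "smooth_strongly_convex L l f"
  shows "l * (norm (x - y))\<^sup>2 / 2 \<le> f y - f x - inner (gradient f x) (y - x)"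
  using assms by (simp add: smooth_strongly_convex_def)

lemma smooth_strongly_convex_upper:
  assumes "smooth_strongly_convex L l f"
  shows "f y - f x - inner (gradient f x) (y - x) \<le> L * (norm (x - y))\<^sup>2 / 2"
  using assms by (simp add: smooth_strongly_convex_def)

lemma smooth_strongly_convex_pos:
  assumes "smooth_strongly_convex L l f"
  shows "0 < l" "0 < L"
  using assms by (auto simp: smooth_strongly_convex_def)

text \<open>Along the line, smoothness bounds the increase of \<open>f\<close> by a quadratic in
  \<open>t\<close> without constant term; line minimality makes it nonnegative, so its linear
  coefficient vanishes.\<close>

lemma gradient_orthogonal_of_line_min:
  assumes "smooth_strongly_convex L l f"
    and line_min: "\<And>t. f x \<le> f (x + t *\<^sub>R d)"
  shows "inner (gradient f x) d = 0"
proof (cases "d = 0")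
  case False
  define p where "p = inner (gradient f x) d"
  define q where "q = L * (norm d)\<^sup>2"
  have "q > 0"
    using False smooth_strongly_convex_pos[OF assms(1)] by (simp add: q_def)
  have "0 \<le> t * p + q * t\<^sup>2 / 2" for t
    using smooth_strongly_convex_upper[OF assms(1), of "x + t *\<^sub>R d" x] line_min[of t]
    by (simp add: p_def q_def power_mult_distrib mult_ac)
  \<comment> \<open>The quadratic is minimal at \<open>- p / q\<close>, with value
    \<open>- p\<^sup>2 / (2 * q)\<close>.\<close>
  from this[of "- p / q"] have "p\<^sup>2 \<le> 0"
    using \<open>q > 0\<close> by (simp add: field_simps power2_eq_square)
  then show ?thesis
    by (simp add: p_def)
qed simp

lemma gradient_minimizer:
  assumes "smooth_strongly_convex L l f" and "is_arg_min f (\<lambda>_. True) xstar"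
  shows "gradient f xstar = 0"
proof -
  have "f xstar \<le> f z" for z
    using assms(2) by (auto simp: is_arg_min_linorder)
  then have "inner (gradient f xstar) (gradient f xstar) = 0"
    by (intro gradient_orthogonal_of_line_min[OF assms(1)])
  then show ?thesis
    by simp
qed

lemma dist_minimizer_le_gamma:
  assumes "smooth_strongly_convex L l f" and "is_arg_min f (\<lambda>_. True) xstar"
  shows "(norm (x - xstar))\<^sup>2 \<le> gd_gamma f l xstar x"
  using smooth_strongly_convex_lower[OF assms(1), of xstar x] gradient_minimizer[OF assms]
    smooth_strongly_convex_pos[OF assms(1)]
  by (simp add: gd_gamma_def field_simps norm_minus_commute)

text \<open>Completing the square in \<open>z\<close> in the strong convexity bound based at
  \<open>x\<close> turns it into a ball condition on \<open>z\<close>.\<close>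

lemma dist_grad_step_le:
  assumes "smooth_strongly_convex L l f"
  shows "(norm (grad_step f l x - z))\<^sup>2 \<le> (gd_rho f l x)\<^sup>2 - gd_gamma f l z x"
proof -
  have l: "0 < l"
    using assms by (rule smooth_strongly_convex_pos)
  have "(norm (grad_step f l x - z))\<^sup>2 =
      (norm (x - z))\<^sup>2 + (gd_rho f l x)\<^sup>2 + 2 / l * inner (gradient f x) (z - x)"
    unfolding grad_step_def gd_rho_def power2_norm_eq_inner power_divide using l
    by (simp add: inner_simps inner_commute field_simps power2_eq_square)
  with smooth_strongly_convex_lower[OF assms, of x z] l show ?thesis
    by (simp add: gd_gamma_def field_simps)
qed

lemma gd_delta_ge_gd_rho:
  assumes "inner (gradient f x) (y - x) = 0"
  shows "(gd_rho f l x)\<^sup>2 \<le> (gd_delta f l x y)\<^sup>2"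
proof -
  have "y - grad_step f l x = (y - x) + (1 / l) *\<^sub>R gradient f x"
    by (simp add: grad_step_def)
  moreover have "orthogonal (y - x) ((1 / l) *\<^sub>R gradient f x)"
    using assms by (simp add: orthogonal_def inner_commute)
  ultimately have "(gd_delta f l x y)\<^sup>2 = (norm (y - x))\<^sup>2 + (gd_rho f l x)\<^sup>2"
    unfolding gd_delta_def gd_rho_def by (simp only: norm_add_Pythagorean) (simp add: power_divide)
  then show ?thesis
    by simp
qed

lemma norm_convex_combination_squared:
  fixes a b z :: "'a::real_inner"
  shows "(norm ((1 - t) *\<^sub>R a + t *\<^sub>R b - z))\<^sup>2 =
    (1 - t) * (norm (a - z))\<^sup>2 + t * (norm (b - z))\<^sup>2 - t * (1 - t) * (norm (b - a))\<^sup>2"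
  unfolding power2_norm_eq_inner by (simp add: inner_simps inner_commute algebra_simps)

text \<open>On negative arguments \<open>sqrt t = - sqrt (- t)\<close>, so the square is \<open>\<bar>t\<bar>\<close>.\<close>

lemma le_sqrt_squared: "t \<le> (sqrt t)\<^sup>2"
  by (simp flip: real_sqrt_power)

lemma gd_step_line_search_orthogonal:
  assumes "smooth_strongly_convex L l f" and "gd_step f L l xstar x y s x' y' s'"
  shows "inner (gradient f x') (y' - x') = 0"
proof (rule gradient_orthogonal_of_line_min[OF assms(1)])
  fix t
  have am: "is_arg_min f (\<lambda>z. z \<in> affine hull {grad_step f L x, y'}) x'"
    using assms(2) unfolding gd_step_def by blast
  \<comment> \<open>Both \<open>x'\<close> and \<open>y'\<close> lie in the search set, hence so
    does the whole line through them.\<close>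
  have "(1 - t) *\<^sub>R x' + t *\<^sub>R y' \<in> affine hull {grad_step f L x, y'}"
    using am by (intro mem_affine affine_affine_hull) (auto simp: is_arg_min_linorder intro: hull_inc)
  moreover have "x' + t *\<^sub>R (y' - x') = (1 - t) *\<^sub>R x' + t *\<^sub>R y'"
    by (simp add: algebra_simps)
  ultimately show "f x' \<le> f (x' + t *\<^sub>R (y' - x'))"
    using am by (simp add: is_arg_min_linorder)
qed

lemma gd_step_enclosing_ball:
  assumes f: "smooth_strongly_convex L l f"
    and orth: "inner (gradient f x) (y - x) = 0"
    and ball: "(norm (y - xstar))\<^sup>2 + gd_gamma f l xstar x \<le> s\<^sup>2"
    and step: "gd_step f L l xstar x y s x' y' s'"
  shows "(norm (y' - xstar))\<^sup>2 + gd_gamma f l xstar x' \<le> s'\<^sup>2"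
proof (cases "gd_case1 f l x s")
  case False
  then have y': "y' = grad_step f l x"
    and s': "s' = sqrt ((gd_rho f l x)\<^sup>2 - gd_gamma f l xstar x + gd_gamma f l xstar x')"
    using step by (simp_all add: gd_step_def gd_lambda_def)
  show ?thesis
    using le_sqrt_squared[of "(gd_rho f l x)\<^sup>2 - gd_gamma f l xstar x + gd_gamma f l xstar x'"]
      dist_grad_step_le[OF f, of x xstar]
    by (simp add: y' s')
next
  case True
  define g where "g = gd_gamma f l xstar x"
  define R where "R = (gd_rho f l x)\<^sup>2"
  define D where "D = (gd_delta f l x y)\<^sup>2"
  define t where "t = gd_lambda f l x y s"
  define A where "A = 2 * R + 2 * s\<^sup>2 - D - (R - s\<^sup>2)\<^sup>2 / D"
  have y': "y' = (1 - t) *\<^sub>R grad_step f l x + t *\<^sub>R y"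
    and s': "s' = sqrt ((gd_xi f l x y s)\<^sup>2 - g + gd_gamma f l xstar x')"
    and "D > 0"
    using step True by (simp_all add: gd_step_def t_def g_def D_def)
  have t: "t = (D + R - s\<^sup>2) / (2 * D)"
    using True by (simp add: t_def gd_lambda_def D_def R_def)
  have "R \<le> D"
    using orth unfolding R_def D_def by (rule gd_delta_ge_gd_rho)
  moreover have "s\<^sup>2 \<le> 2 * R"
    using True by (simp add: gd_case1_def R_def)
  moreover have "0 \<le> s\<^sup>2" by simp
  ultimately have "0 \<le> D + R - s\<^sup>2" "D + R - s\<^sup>2 \<le> 2 * D"
    by linarith+
  with \<open>D > 0\<close> have "0 \<le> t" "t \<le> 1"
    by (simp_all add: t)
  have "(norm (y' - xstar))\<^sup>2 =
      (1 - t) * (norm (grad_step f l x - xstar))\<^sup>2 + t * (norm (y - xstar))\<^sup>2 - t * (1 - t) * D"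
    by (simp add: y' norm_convex_combination_squared D_def gd_delta_def)
  also have "\<dots> \<le> (1 - t) * (R - g) + t * (s\<^sup>2 - g) - t * (1 - t) * D"
    using \<open>0 \<le> t\<close> \<open>t \<le> 1\<close> dist_grad_step_le[OF f, of x xstar] ball
    by (intro diff_right_mono add_mono mult_left_mono) (simp_all add: R_def g_def)
  \<comment> \<open>As a quadratic in \<open>t\<close> with leading coefficient \<open>D\<close>,
    the bound is minimal exactly at this \<open>t\<close>; \<open>A / 4 - g\<close> is its
    minimum.\<close>
  also have "\<dots> = A / 4 - g"
    using \<open>D > 0\<close> by (simp add: A_def t field_simps power2_eq_square)
  also have "\<dots> \<le> (sqrt A)\<^sup>2 / 4 - g"
    using le_sqrt_squared[of A] by simp
  also have "\<dots> = (gd_xi f l x y s)\<^sup>2 - g"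
    by (simp add: gd_xi_def A_def R_def D_def power_divide)
  finally show ?thesis
    using le_sqrt_squared[of "(gd_xi f l x y s)\<^sup>2 - g + gd_gamma f l xstar x'"]
    by (simp add: s')
qed

text \<open>Orthogonality is carried through the induction because the next step uses it to place
  its weight in \<open>[0, 1]\<close>. At index 0 it is trivial, since
  \<open>y 0 = x 0\<close>.\<close>

lemma gd_run_enclosing_ball:
  assumes f: "smooth_strongly_convex L l f"
    and min: "is_arg_min f (\<lambda>_. True) xstar"
    and run: "gd_run f L l xstar N x y s"
    and "k \<le> N"
  shows "inner (gradient f (x k)) (y k - x k) = 0 \<and>
    (norm (y k - xstar))\<^sup>2 + gd_gamma f l xstar (x k) \<le> (s k)\<^sup>2"
  using \<open>k \<le> N\<close>
proof (induction k)
  case 0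
  have "y 0 = x 0" and s0: "(s 0)\<^sup>2 = 2 * (gd_rho f l (x 0))\<^sup>2"
    using run by (simp_all add: gd_run_def gd_rho_def power_mult_distrib power_divide)
  \<comment> \<open>The squared radius of a ball containing \<open>xstar\<close> is nonnegative. The
    factor 2 in \<open>s0\<close> pays for this bound twice: once for \<open>gd_gamma\<close> itself
    and once for the squared distance, which is at most \<open>gd_gamma\<close>.\<close>
  moreover have "gd_gamma f l xstar (x 0) \<le> (gd_rho f l (x 0))\<^sup>2"
    using dist_grad_step_le[OF f, of "x 0" xstar]
      zero_le_power2[of "norm (grad_step f l (x 0) - xstar)"] by linarith
  ultimately show ?case
    using dist_minimizer_le_gamma[OF f min, of "x 0"] by simp
next
  case (Suc k)
  have step: "gd_step f L l xstar (x k) (y k) (s k) (x (Suc k)) (y (Suc k)) (s (Suc k))"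
    using run Suc.prems by (force simp: gd_run_def)
  show ?case
    using gd_step_line_search_orthogonal[OF f step] gd_step_enclosing_ball[OF f _ _ step] Suc
    by simp
qed

theorem theorem2:
  fixes f :: "real ^ 'n \<Rightarrow> real"
    and L l :: real
    and xstar :: "real ^ 'n"
    and N :: nat
    and x y :: "nat \<Rightarrow> real ^ 'n"
    and s :: "nat \<Rightarrow> real"
  assumes "smooth_strongly_convex L l f"
    and "is_arg_min f (\<lambda>_. True) xstar"
    and "gd_run f L l xstar N x y s"
  shows "\<forall>k\<in>{1..N}. (s k)\<^sup>2 \<ge> (norm (y k - xstar))\<^sup>2 + 2 * (f (x k) - f xstar) / l"
  using gd_run_enclosing_ball[OF assms] by (simp add: gd_gamma_def)

end
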